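(* Let $T$ be a tolerance on $U$ induced by an irredundant covering of $U$ and let $E$ be an equivalence on $U$ such that $T$ is $E$-compatible. Then the following are equivalent: (a) $\mathit{RS}(E,T)$ is a complete sublattice of $\wp(U)_E \times \wp(U)^T$. (b) For each $x \in \Sigma_E \setminus \Sigma_T$, there exists an element $y \in U$ with $y \notin \Sigma_E$ and $T(y) \subseteq T(x)$.
   Context: A tolerance is a reflexive and symmetric binary relation. For a binary relation $R$ on $U$ and $x \in U$, $R(x) = \{y \in U \mid x \, R \, y\}$; for an equivalence $E$, $[x]_E = E(x)$. For $X \subseteq U$, $X_R = \{x \in U \mid R(x) \subseteq X\}$ and $X^R = \{x \in U \mid R(x) \cap X \neq \emptyset\}$. With $E \circ T = \{(x,y) \mid (\exists z)\ x \, E \, z \text{ and } z \, T \, y\}$, $T$ is $E$-compatible if $E \circ T \subseteq T$. A covering of $U$ is a collection $\mathcal{C}$ of nonempty subsets of $U$ with $\bigcup \mathcal{C} = U$; it is irredundant if $\mathcal{C} \setminus \{B\}$ is not a covering of $U$ for any $B \in \mathcal{C}$. The tolerance induced by $\mathcal{C}$ is $\{(x,y) \mid (\exists B \in \mathcal{C})\ x,y \in B\}$. Put $\Sigma_E = \{x \in U \mid [x]_E = \{x\}\}$ and $\Sigma_T = \{x \in U \mid T(x) = \{x\}\}$. $\mathit{RS}(E,T) = \{(X_E,X^T) \mid X \subseteq U\}$. Let $\wp(U)_E = \{X_E \mid X \subseteq U\}$ and $\wp(U)^T = \{X^T \mid X \subseteq U\}$, each ordered by inclusion; these are complete lattices: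 in $\wp(U)_E$ joins are unions and meets are intersections, while in $\wp(U)^T$ joins are unions and $\bigwedge_{X \in \mathcal{H}} X^T = ((\bigcap_{X\in\mathcal{H}} X^T)_T)^T$ (the empty intersection being $U$). Their Cartesian product is ordered coordinatewise. A complete sublattice of a complete lattice $L$ is a nonempty $H \subseteq L$ such that $\bigvee_L S, \bigwedge_L S \in H$ for every $S \subseteq H$. *)

theory Defs
  imports "HOL-Algebra.Complete_Lattice"
begin

text \<open>Relations on \<open>U\<close> are sets of pairs contained in \<open>U \<times> U\<close>; the neighbourhood \<open>R(x)\<close> is the
  image \<open>R `` {x}\<close>, equivalences are the library's \<^const>\<open>equiv\<close>, and the composition used for
  compatibility is the library's \<open>E O T\<close> (first \<open>E\<close>, then \<open>T\<close>).\<close>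

definition tolerance :: "'a set \<Rightarrow> ('a \<times> 'a) set \<Rightarrow> bool" where
  "tolerance U T \<longleftrightarrow> T \<subseteq> U \<times> U \<and> refl_on U T \<and> sym T"

definition compatible :: "('a \<times> 'a) set \<Rightarrow> ('a \<times> 'a) set \<Rightarrow> bool" where
  "compatible E T \<longleftrightarrow> E O T \<subseteq> T"

definition covering :: "'a set \<Rightarrow> 'a set set \<Rightarrow> bool" where
  "covering U \<C> \<longleftrightarrow> {} \<notin> \<C> \<and> \<Union>\<C> = U"

definition irredundant_covering :: "'a set \<Rightarrow> 'a set set \<Rightarrow> bool" where
  "irredundant_covering U \<C> \<longleftrightarrow> covering U \<C> \<and> (\<forall>B\<in>\<C>. \<not> covering U (\<C> - {B}))"

definition induced_tolerance :: "'a set set \<Rightarrow> ('a \<times> 'a) set" where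
  "induced_tolerance \<C> = {(x, y). \<exists>B\<in>\<C>. x \<in> B \<and> y \<in> B}"

definition lower_approx :: "'a set \<Rightarrow> ('a \<times> 'a) set \<Rightarrow> 'a set \<Rightarrow> 'a set" where
  "lower_approx U R X = {x \<in> U. R `` {x} \<subseteq> X}"

definition upper_approx :: "'a set \<Rightarrow> ('a \<times> 'a) set \<Rightarrow> 'a set \<Rightarrow> 'a set" where
  "upper_approx U R X = {x \<in> U. R `` {x} \<inter> X \<noteq> {}}"

definition singletons :: "'a set \<Rightarrow> ('a \<times> 'a) set \<Rightarrow> 'a set" where
  "singletons U R = {x \<in> U. R `` {x} = {x}}"

definition rough_sets ::
  "'a set \<Rightarrow> ('a \<times> 'a) set \<Rightarrow> ('a \<times> 'a) set \<Rightarrow> ('a set \<times> 'a set) set" where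
  "rough_sets U E T = (\<lambda>X. (lower_approx U E X, upper_approx U T X)) ` Pow U"

definition inclusion_order :: "'a set set \<Rightarrow> 'a set gorder" where
  "inclusion_order \<A> = \<lparr>carrier = \<A>, eq = (=), le = (\<subseteq>)\<rparr>"

definition product_order :: "'a gorder \<Rightarrow> 'b gorder \<Rightarrow> ('a \<times> 'b) gorder" where
  "product_order L M =
     \<lparr>carrier = carrier L \<times> carrier M, eq = (=),
      le = (\<lambda>p q. fst p \<sqsubseteq>\<^bsub>L\<^esub> fst q \<and> snd p \<sqsubseteq>\<^bsub>M\<^esub> snd q)\<rparr>"

definition lower_lattice :: "'a set \<Rightarrow> ('a \<times> 'a) set \<Rightarrow> 'a set gorder" where
  "lower_lattice U R = inclusion_order (lower_approx U R ` Pow U)"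

definition upper_lattice :: "'a set \<Rightarrow> ('a \<times> 'a) set \<Rightarrow> 'a set gorder" where
  "upper_lattice U R = inclusion_order (upper_approx U R ` Pow U)"

text \<open>The suprema and infima are those of \<open>L\<close>, also for \<open>S = {}\<close>, so \<open>H\<close> contains the
  least and the greatest element of \<open>L\<close>.\<close>

definition complete_sublattice :: "'a set \<Rightarrow> 'a gorder \<Rightarrow> bool" where
  "complete_sublattice H L \<longleftrightarrow>
     complete_lattice L \<and> H \<noteq> {} \<and> H \<subseteq> carrier L \<and>
     (\<forall>S\<subseteq>H. \<Squnion>\<^bsub>L\<^esub>S \<in> H \<and> \<Sqinter>\<^bsub>L\<^esub>S \<in> H)"

text \<open>In the situation of interest the required completeness of the ambient lattice is
  automatic, and joins and meets are given by the usual formulas, including for \<open>S = {}\<close>.\<close>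

lemma lower_approx_image_iff:
  assumes "equiv U E"
  shows "A \<in> lower_approx U E ` Pow U \<longleftrightarrow> A \<subseteq> U \<and> E `` A \<subseteq> A"
proof
  assume "A \<in> lower_approx U E ` Pow U"
  then show "A \<subseteq> U \<and> E `` A \<subseteq> A"
    using assms unfolding lower_approx_def equiv_def trans_def by blast
next
  assume A: "A \<subseteq> U \<and> E `` A \<subseteq> A"
  then have "A = lower_approx U E A"
    using assms unfolding lower_approx_def equiv_def refl_on_def by blast
  then show "A \<in> lower_approx U E ` Pow U"
    using A by blast
qed

lemma upper_lower_approx_greatest:
  assumes "tolerance U T" "W \<subseteq> U"
  shows "upper_approx U T (lower_approx U T W) \<subseteq> W"
    and "B \<in> upper_approx U T ` Pow U \<Longrightarrow> B \<subseteq> W \<Longrightarrow>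
         B \<subseteq> upper_approx U T (lower_approx U T W)"
proof -
  have T: "(y, x) \<in> T \<and> x \<in> U \<and> y \<in> U" if "(x, y) \<in> T" for x y
    using assms(1) that by (auto simp: tolerance_def dest: symD)
  show "upper_approx U T (lower_approx U T W) \<subseteq> W"
    using T unfolding upper_approx_def lower_approx_def by blast
  assume "B \<in> upper_approx U T ` Pow U" and BW: "B \<subseteq> W"
  then obtain X where X: "X \<subseteq> U" "B = upper_approx U T X"
    by blast
  have "X \<subseteq> lower_approx U T W"
    using X BW T unfolding upper_approx_def lower_approx_def by blast
  then show "B \<subseteq> upper_approx U T (lower_approx U T W)"
    unfolding X upper_approx_def by blast
qed

lemma upper_approx_Union:
  assumes "\<B> \<subseteq> upper_approx U T ` Pow U"
  shows "\<Union>\<B> \<in> upper_approx U T ` Pow U"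
proof -
  obtain \<X> where "\<X> \<subseteq> Pow U" "\<B> = upper_approx U T ` \<X>"
    using assms by (auto simp: subset_image_iff)
  then have "\<Union>\<B> = upper_approx U T (\<Union>\<X>)" "\<Union>\<X> \<in> Pow U"
    by (auto simp: upper_approx_def)
  then show ?thesis by blast
qed

context
  fixes U :: "'a set" and E T :: "('a \<times> 'a) set" and L :: "('a set \<times> 'a set) gorder"
  assumes E: "equiv U E" and T: "tolerance U T"
  defines "L \<equiv> product_order (lower_lattice U E) (upper_lattice U T)"
begin

lemma carrier_product:
  "carrier L = lower_approx U E ` Pow U \<times> upper_approx U T ` Pow U"
  by (simp add: L_def product_order_def lower_lattice_def upper_lattice_def inclusion_order_def)

lemma le_product: "p \<sqsubseteq>\<^bsub>L\<^esub> q \<longleftrightarrow> fst p \<subseteq> fst q \<and> snd p \<subseteq> snd q"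
  by (simp add: L_def product_order_def lower_lattice_def upper_lattice_def inclusion_order_def)

lemma eq_product: "(.=\<^bsub>L\<^esub>) = (=)"
  by (simp add: L_def product_order_def)

lemma least_product:
  assumes S: "S \<subseteq> carrier L"
  shows "least L (\<Union>(fst ` S), \<Union>(snd ` S)) (Upper L S)"
proof -
  let ?j = "(\<Union>(fst ` S), \<Union>(snd ` S))"
  have sub: "\<And>A. A \<in> fst ` S \<Longrightarrow> A \<in> lower_approx U E ` Pow U"
    and "snd ` S \<subseteq> upper_approx U T ` Pow U"
    using S unfolding carrier_product by auto
  from this(2) have "\<Union>(snd ` S) \<in> upper_approx U T ` Pow U"
    by (rule upper_approx_Union)
  moreover have "\<Union>(fst ` S) \<in> lower_approx U E ` Pow U"
    using sub unfolding lower_approx_image_iff[OF E] by blast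
  ultimately have "?j \<in> carrier L"
    unfolding carrier_product by simp
  moreover have "p \<sqsubseteq>\<^bsub>L\<^esub> ?j" if "p \<in> S" for p
    using that unfolding le_product fst_conv snd_conv by blast
  ultimately have "?j \<in> Upper L S"
    by (simp add: Upper_def)
  moreover have "?j \<sqsubseteq>\<^bsub>L\<^esub> q" if "q \<in> Upper L S" for q
  proof -
    have "p \<sqsubseteq>\<^bsub>L\<^esub> q" if "p \<in> S" for p
      using that \<open>q \<in> Upper L S\<close> S unfolding Upper_def by blast
    then show ?thesis
      unfolding le_product fst_conv snd_conv by blast
  qed
  ultimately show ?thesis
    unfolding least_def by (simp add: Upper_closed)
qed

lemma greatest_product:
  assumes S: "S \<subseteq> carrier L"
  shows "greatest L (U \<inter> \<Inter>(fst ` S), upper_approx U T (lower_approx U T (U \<inter> \<Inter>(snd ` S)))) (Lower L S)"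
    (is "greatest L (?A, ?B) _")
proof -
  have sub: "p \<in> carrier L \<Longrightarrow> fst p \<subseteq> U \<and> snd p \<subseteq> U" for p
    unfolding carrier_product lower_approx_def upper_approx_def by auto
  have "fst ` S \<subseteq> lower_approx U E ` Pow U"
    using S unfolding carrier_product by auto
  moreover have "E `` U \<subseteq> U"
    using E by (auto simp: equiv_def)
  ultimately have "?A \<in> lower_approx U E ` Pow U"
    unfolding subset_eq[of "fst ` S"] lower_approx_image_iff[OF E] by blast
  moreover have "?B \<in> upper_approx U T ` Pow U"
    by (rule imageI) (auto simp: lower_approx_def)
  ultimately have carr: "(?A, ?B) \<in> carrier L"
    unfolding carrier_product by simp
  have B: "?B \<subseteq> U \<inter> \<Inter>(snd ` S)"
    by (rule upper_lower_approx_greatest(1)[OF T]) simp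
  have "(?A, ?B) \<sqsubseteq>\<^bsub>L\<^esub> p" if "p \<in> S" for p
    using that B unfolding le_product fst_conv snd_conv by blast
  then have low: "(?A, ?B) \<in> Lower L S"
    using carr by (simp add: Lower_def)
  have "p \<sqsubseteq>\<^bsub>L\<^esub> (?A, ?B)" if p: "p \<in> Lower L S" for p
  proof -
    have pc: "p \<in> carrier L" and pl: "\<And>q. q \<in> S \<Longrightarrow> fst p \<subseteq> fst q \<and> snd p \<subseteq> snd q"
      using p S unfolding Lower_def le_product by blast+
    have "fst p \<subseteq> ?A"
      using sub[OF pc] pl by blast
    moreover have "snd p \<subseteq> ?B"
    proof (rule upper_lower_approx_greatest(2)[OF T])
      show "snd p \<in> upper_approx U T ` Pow U"
        using pc unfolding carrier_product by auto
      show "snd p \<subseteq> U \<inter> \<Inter>(snd ` S)"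
        using sub[OF pc] pl by blast
    qed simp
    ultimately show ?thesis by (simp add: le_product)
  qed
  then show ?thesis
    using low unfolding greatest_def by (simp add: Lower_closed)
qed

lemma complete_lattice_product: "complete_lattice L"
proof -
  have "partial_order L"
    by unfold_locales (auto simp: eq_product le_product prod_eq_iff)
  then show ?thesis
    by (rule partial_order.complete_latticeI) (blast intro: least_product greatest_product)+
qed

end

end

theory Submission
  imports Defs
begin

text \<open>Every block \<open>B\<close> of an irredundant covering is the neighbourhood \<open>T(b)\<close> of some point \<open>b\<close>
  lying in no other block. Under (b), the pairs in \<open>RS(E,T)\<close> are exactly the
  \<open>(A, Z) \<in> \<wp>(U)\<^sub>E \<times> \<wp>(U)\<^sup>T\<close> with \<open>A\<^sup>T \<subseteq> Z\<close> and \<open>Z \<inter> \<Sigma>\<^sub>T \<subseteq> A\<close>, two conditions stable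
  under arbitrary joins and meets. Conversely, if \<open>x \<in> \<Sigma>\<^sub>E \<setminus> \<Sigma>\<^sub>T\<close>, take a block \<open>B = T(b)\<close>
  containing \<open>x\<close> and some \<open>z \<noteq> b\<close>. The meet of the pairs of \<open>{b}\<close> and \<open>{z}\<close> is \<open>({}, B)\<close>;
  if it is the pair of a set \<open>X\<close>, then \<open>X\<close> is nonempty and contains no point of \<open>\<Sigma>\<^sub>E\<close>, and
  \<open>T(y) \<subseteq> B \<subseteq> T(x)\<close> for each \<open>y \<in> X\<close>.\<close>

lemma toleranceD:
  assumes "tolerance U T"
  shows "(x, y) \<in> T \<Longrightarrow> x \<in> U" "(x, y) \<in> T \<Longrightarrow> y \<in> U" "(x, y) \<in> T \<Longrightarrow> (y, x) \<in> T"
    and "x \<in> U \<Longrightarrow> (x, x) \<in> T"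
  using assms by (auto simp: tolerance_def dest: symD refl_onD)

lemma equivD:
  assumes "equiv U E"
  shows "(x, y) \<in> E \<Longrightarrow> x \<in> U" "(x, y) \<in> E \<Longrightarrow> y \<in> U" "(x, y) \<in> E \<Longrightarrow> (y, x) \<in> E"
    and "x \<in> U \<Longrightarrow> (x, x) \<in> E"
  using assms by (auto simp: equiv_def dest: symD refl_onD)

text \<open>Compatibility carries \<open>T\<close>-neighbours backwards along a pair of
  \<open>E\<close>; the symmetry of \<open>E\<close> gives both inclusions.\<close>

lemma compatible_Image_eq:
  assumes "equiv U E" "compatible E T" "(x, y) \<in> E"
  shows "T `` {x} = T `` {y}"
  using assms(2,3) equivD(3)[OF assms(1)] unfolding compatible_def by blast

lemma compatible_subset:
  assumes "tolerance U T" "equiv U E" "compatible E T"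
  shows "E \<subseteq> T"
  using assms(3) toleranceD(4)[OF assms(1)] equivD(2)[OF assms(2)]
  unfolding compatible_def by (auto intro!: relcompI)

text \<open>Deleting \<open>B\<close> must leave some point \<open>b\<close> uncovered. Then
  \<open>B\<close> is the only block through \<open>b\<close>, so every point sharing a block with
  \<open>b\<close> lies in \<open>B\<close>.\<close>

lemma irredundant_covering_block_eq_Image:
  assumes "irredundant_covering U \<C>" "B \<in> \<C>"
  obtains b where "b \<in> B" "induced_tolerance \<C> `` {b} = B"
proof -
  have cov: "covering U \<C>" and "\<not> covering U (\<C> - {B})"
    using assms by (auto simp: irredundant_covering_def)
  then have "\<Union>(\<C> - {B}) \<noteq> \<Union>\<C>"
    by (auto simp: covering_def)
  then obtain b where b: "b \<in> \<Union>\<C>" "b \<notin> \<Union>(\<C> - {B})" by blast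
  then have "b \<in> B" by blast
  moreover have "induced_tolerance \<C> `` {b} = B"
    using b \<open>B \<in> \<C>\<close> \<open>b \<in> B\<close> unfolding induced_tolerance_def by blast
  ultimately show ?thesis by (rule that)
qed

lemma upper_approx_singleton:
  assumes "tolerance U T"
  shows "upper_approx U T {b} = T `` {b}"
  using toleranceD[OF assms] unfolding upper_approx_def by blast

text \<open>\<open>sup_def\<close> selects a least upper bound by choice; antisymmetry of inclusion
  identifies it with the explicit pair, also for empty \<open>S\<close>.\<close>

lemma sup_product:
  assumes "equiv U E" "tolerance U T"
    and "S \<subseteq> carrier (product_order (lower_lattice U E) (upper_lattice U T))"
  shows "\<Squnion>\<^bsub>product_order (lower_lattice U E) (upper_lattice U T)\<^esub>S = (\<Union>(fst ` S), \<Union>(snd ` S))"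
proof -
  let ?L = "product_order (lower_lattice U E) (upper_lattice U T)"
  note l = least_product[OF assms]
  have "least ?L (\<Squnion>\<^bsub>?L\<^esub>S) (Upper ?L S)"
    unfolding sup_def using l by (rule someI)
  with l have "\<Squnion>\<^bsub>?L\<^esub>S \<sqsubseteq>\<^bsub>?L\<^esub> (\<Union>(fst ` S), \<Union>(snd ` S))"
    and "(\<Union>(fst ` S), \<Union>(snd ` S)) \<sqsubseteq>\<^bsub>?L\<^esub> \<Squnion>\<^bsub>?L\<^esub>S"
    unfolding least_def by blast+
  then show ?thesis
    unfolding le_product[OF assms(1,2)] prod_eq_iff by (intro conjI equalityI) simp_all
qed

lemma inf_product:
  assumes "equiv U E" "tolerance U T"
    and "S \<subseteq> carrier (product_order (lower_lattice U E) (upper_lattice U T))"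
  shows "\<Sqinter>\<^bsub>product_order (lower_lattice U E) (upper_lattice U T)\<^esub>S =
    (U \<inter> \<Inter>(fst ` S), upper_approx U T (lower_approx U T (U \<inter> \<Inter>(snd ` S))))"
proof -
  let ?L = "product_order (lower_lattice U E) (upper_lattice U T)"
  note g = greatest_product[OF assms]
  have "greatest ?L (\<Sqinter>\<^bsub>?L\<^esub>S) (Lower ?L S)"
    unfolding inf_def using g by (rule someI)
  with g have "\<Sqinter>\<^bsub>?L\<^esub>S \<sqsubseteq>\<^bsub>?L\<^esub> (U \<inter> \<Inter>(fst ` S), upper_approx U T (lower_approx U T (U \<inter> \<Inter>(snd ` S))))"
    and "(U \<inter> \<Inter>(fst ` S), upper_approx U T (lower_approx U T (U \<inter> \<Inter>(snd ` S)))) \<sqsubseteq>\<^bsub>?L\<^esub> \<Sqinter>\<^bsub>?L\<^esub>S"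
    unfolding greatest_def by blast+
  then show ?thesis
    unfolding le_product[OF assms(1,2)] prod_eq_iff by (intro conjI equalityI) simp_all
qed

text \<open>For the converse direction, \<open>A\<close> is enlarged by one point outside
  \<open>singletons U E\<close> for each non-trivial block inside \<open>Z\<close>. These points
  generate \<open>Z\<close> under the upper approximation, yet complete no new
  \<open>E\<close>-class, so the lower approximation stays \<open>A\<close>.\<close>

lemma rough_sets_iff:
  assumes tol: "tolerance U T" and irr: "irredundant_covering U \<C>"
    and ind: "T = induced_tolerance \<C>" and E: "equiv U E" and comp: "compatible E T"
    and dense: "\<forall>x \<in> singletons U E - singletons U T.
      \<exists>y\<in>U. y \<notin> singletons U E \<and> T `` {y} \<subseteq> T `` {x}"
  shows "(A, Z) \<in> rough_sets U E T \<longleftrightarrow>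
    A \<in> lower_approx U E ` Pow U \<and> Z \<in> upper_approx U T ` Pow U \<and>
    upper_approx U T A \<subseteq> Z \<and> Z \<inter> singletons U T \<subseteq> A"
proof
  assume "(A, Z) \<in> rough_sets U E T"
  then obtain X where X: "X \<subseteq> U" "A = lower_approx U E X" "Z = upper_approx U T X"
    unfolding rough_sets_def by blast
  have "A \<subseteq> X"
    using equivD(4)[OF E] unfolding X lower_approx_def by blast
  then have "upper_approx U T A \<subseteq> Z"
    unfolding X(3) upper_approx_def by blast
  moreover have "Z \<inter> singletons U T \<subseteq> A"
  proof
    fix x assume x: "x \<in> Z \<inter> singletons U T"
    \<comment> \<open>The only \<open>T\<close>-neighbour of \<open>x\<close> is \<open>x\<close>
      itself, so it must be the one in \<open>X\<close>; and \<open>E \<subseteq> T\<close> makes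
      the \<open>E\<close>-class trivial.\<close>
    then have "x \<in> X" "E `` {x} \<subseteq> {x}"
      using compatible_subset[OF tol E comp] by (auto simp: X upper_approx_def singletons_def)
    then show "x \<in> A"
      using X(1) by (auto simp: X(2) lower_approx_def)
  qed
  ultimately show "A \<in> lower_approx U E ` Pow U \<and> Z \<in> upper_approx U T ` Pow U \<and>
    upper_approx U T A \<subseteq> Z \<and> Z \<inter> singletons U T \<subseteq> A"
    using X by blast
next
  assume *: "A \<in> lower_approx U E ` Pow U \<and> Z \<in> upper_approx U T ` Pow U \<and>
    upper_approx U T A \<subseteq> Z \<and> Z \<inter> singletons U T \<subseteq> A"
  then have A: "A \<subseteq> U" "E `` A \<subseteq> A" and AZ: "upper_approx U T A \<subseteq> Z" "Z \<inter> singletons U T \<subseteq> A"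
    using lower_approx_image_iff[OF E] by blast+
  from * obtain W where W: "W \<subseteq> U" "Z = upper_approx U T W" by blast
  define good where "good B \<longleftrightarrow> (\<exists>y\<in>U. y \<notin> singletons U E \<and> T `` {y} = B)" for B
  define g where "g B = (SOME y. y \<in> U \<and> y \<notin> singletons U E \<and> T `` {y} = B)" for B
  have g: "g B \<in> U \<and> g B \<notin> singletons U E \<and> T `` {g B} = B" if "good B" for B
    unfolding g_def by (rule someI_ex) (use that in \<open>auto simp: good_def\<close>)
  have good: "good B \<or> (\<exists>x\<in>singletons U T. B = {x})" if B: "B \<in> \<C>" for B
  proof -
    from irredundant_covering_block_eq_Image[OF irr B] ind
    obtain b where b: "b \<in> B" "T `` {b} = B" by metis
    have bU: "b \<in> U" using b toleranceD(1)[OF tol] by blast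
    consider "b \<notin> singletons U E" | "b \<in> singletons U T" | "b \<in> singletons U E - singletons U T"
      by blast
    then show ?thesis
    proof cases
      case 1
      then show ?thesis using b bU by (auto simp: good_def)
    next
      case 2
      then show ?thesis using b by (auto simp: singletons_def)
    next
      \<comment> \<open>The point \<open>y\<close> given by \<open>dense\<close> for
        \<open>b\<close> lies in \<open>T(y) \<subseteq> B\<close>, and the block \<open>B\<close>
        lies in the neighbourhood of each of its points; hence \<open>T(y) = B\<close>.\<close>
      case 3
      with dense b obtain y where y: "y \<in> U" "y \<notin> singletons U E" "T `` {y} \<subseteq> B" by blast
      have "y \<in> B" using y toleranceD(4)[OF tol] by blast
      then have "B \<subseteq> T `` {y}"
        using B unfolding ind induced_tolerance_def by blast
      with y show ?thesis unfolding good_def by blast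
    qed
  qed
  define X where "X = A \<union> g ` {B. good B \<and> B \<subseteq> Z}"
  have XU: "X \<subseteq> U" using A g unfolding X_def by blast
  have "lower_approx U E X = A"
  proof
    show "A \<subseteq> lower_approx U E X"
      using A unfolding X_def lower_approx_def by blast
    show "lower_approx U E X \<subseteq> A"
    proof
      fix x assume x: "x \<in> lower_approx U E X"
      show "x \<in> A"
      proof (rule ccontr)
        assume "x \<notin> A"
        \<comment> \<open>\<open>A\<close> is a union of \<open>E\<close>-classes, so the class of
          \<open>x\<close> avoids \<open>A\<close> and consists of chosen points only.\<close>
        have out: "\<exists>B. good B \<and> z = g B" if "(x, z) \<in> E" for z
        proof -
          have "z \<notin> A" using that \<open>x \<notin> A\<close> A(2) equivD(3)[OF E] by blast
          moreover have "z \<in> X" using that x by (auto simp: lower_approx_def)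
          ultimately show ?thesis unfolding X_def by blast
        qed
        have xU: "x \<in> U" using x by (simp add: lower_approx_def)
        obtain B where B: "good B" "x = g B" using out equivD(4)[OF E xU] by blast
        have "x \<notin> singletons U E" using g B by blast
        then obtain z where z: "(x, z) \<in> E" "z \<noteq> x"
          using xU equivD(4)[OF E xU] unfolding singletons_def by blast
        \<comment> \<open>distinct chosen points have distinct neighbourhoods, so no class contains two of them\<close>
        obtain B' where B': "good B'" "z = g B'" using out z by blast
        have "T `` {x} = T `` {z}" by (rule compatible_Image_eq[OF E comp z(1)])
        then have "B = B'" using g B B' by metis
        then show False using B B' z by blast
      qed
    qed
  qed
  moreover have "upper_approx U T X = Z"
  proof
    show "upper_approx U T X \<subseteq> Z"
    proof
      fix u assume "u \<in> upper_approx U T X"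
      then obtain w where w: "u \<in> U" "(u, w) \<in> T" "w \<in> X"
        by (auto simp: upper_approx_def)
      then consider "w \<in> A" | B where "good B" "B \<subseteq> Z" "w = g B"
        unfolding X_def by blast
      then show "u \<in> Z"
      proof cases
        case 1
        then show ?thesis using w AZ(1) unfolding upper_approx_def by blast
      next
        case 2
        then show ?thesis using g[of B] w toleranceD(3)[OF tol] by blast
      qed
    qed
    show "Z \<subseteq> upper_approx U T X"
    proof
      fix u assume u: "u \<in> Z"
      then obtain w where w: "u \<in> U" "(u, w) \<in> T" "w \<in> W"
        unfolding W upper_approx_def by blast
      then obtain B where B: "B \<in> \<C>" "u \<in> B" "w \<in> B"
        unfolding ind induced_tolerance_def by blast
      \<comment> \<open>All points of \<open>B\<close> are \<open>T\<close>-related to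
        \<open>w\<close>, which lies in \<open>W\<close>.\<close>
      have BZ: "B \<subseteq> Z"
        using B w toleranceD(1)[OF tol] unfolding W upper_approx_def ind induced_tolerance_def
        by blast
      from good[OF B(1)] consider "good B" | "u \<in> singletons U T" using B by blast
      then show "u \<in> upper_approx U T X"
      proof cases
        case 1
        then have "(u, g B) \<in> T" "g B \<in> X"
          using g[OF 1] B BZ toleranceD(3)[OF tol] unfolding X_def by blast+
        then show ?thesis using w unfolding upper_approx_def by blast
      next
        case 2
        then have "u \<in> X" using AZ u unfolding X_def by blast
        then show ?thesis using w toleranceD(4)[OF tol] unfolding upper_approx_def by blast
      qed
    qed
  qed
  ultimately show "(A, Z) \<in> rough_sets U E T"
    using XU unfolding rough_sets_def by blast
qed

theorem theorem4p1:
  fixes U :: "'a set" and E T :: "('a \<times> 'a) set" and \<C> :: "'a set set"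
  assumes "tolerance U T"
    and "irredundant_covering U \<C>"
    and "T = induced_tolerance \<C>"
    and "equiv U E"
    and "compatible E T"
  shows "complete_sublattice (rough_sets U E T)
           (product_order (lower_lattice U E) (upper_lattice U T)) \<longleftrightarrow>
         (\<forall>x \<in> singletons U E - singletons U T.
            \<exists>y\<in>U. y \<notin> singletons U E \<and> T `` {y} \<subseteq> T `` {x})"
    (is "complete_sublattice ?RS ?L \<longleftrightarrow> ?dense")
proof
  note tol = assms(1) and ind = assms(3) and E = assms(4)
  assume sub: "complete_sublattice ?RS ?L"
  show ?dense
  proof
    fix x assume x: "x \<in> singletons U E - singletons U T"
    then have "x \<in> U" "T `` {x} \<noteq> {x}" by (auto simp: singletons_def)
    then obtain w where "(x, w) \<in> T" "w \<noteq> x"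
      using toleranceD(4)[OF tol] by blast
    then obtain B where B: "B \<in> \<C>" "x \<in> B" "w \<in> B"
      unfolding ind induced_tolerance_def by blast
    from irredundant_covering_block_eq_Image[OF assms(2) B(1)] ind
    obtain b where b: "b \<in> B" "T `` {b} = B" by metis
    \<comment> \<open>\<open>B\<close> contains the two distinct points \<open>x\<close> and
      \<open>w\<close>, at least one of which differs from \<open>b\<close>.\<close>
    obtain z where z: "z \<in> B" "z \<noteq> b" using B \<open>w \<noteq> x\<close> by blast
    have BT: "B \<subseteq> T `` {y}" if "y \<in> B" for y
      using B that unfolding ind induced_tolerance_def by blast
    have BU: "B \<subseteq> U" using b toleranceD(2)[OF tol] by blast
    let ?p = "\<lambda>y. (lower_approx U E {y}, upper_approx U T {y})"
    let ?S = "{?p b, ?p z}"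
    have S: "?S \<subseteq> ?RS" using b z BU unfolding rough_sets_def by blast
    then have meet: "\<Sqinter>\<^bsub>?L\<^esub>?S \<in> ?RS" and car: "?S \<subseteq> carrier ?L"
      using sub unfolding complete_sublattice_def by blast+
    have "U \<inter> \<Inter>(snd ` ?S) = B"
      using b BT[OF z(1)] BU by (auto simp: upper_approx_singleton[OF tol])
    \<comment> \<open>\<open>B\<close> is the upper approximation of \<open>{b}\<close>, so it is
      already an element of the upper lattice and the meet formula leaves it unchanged.\<close>
    moreover have "upper_approx U T (lower_approx U T B) = B"
    proof
      show "upper_approx U T (lower_approx U T B) \<subseteq> B"
        by (rule upper_lower_approx_greatest(1)[OF tol BU])
      have "B \<in> upper_approx U T ` Pow U"
        using upper_approx_singleton[OF tol, of b] b BU by blast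
      then show "B \<subseteq> upper_approx U T (lower_approx U T B)"
        by (rule upper_lower_approx_greatest(2)[OF tol BU]) simp
    qed
    \<comment> \<open>The lower approximations of \<open>{b}\<close> and \<open>{z}\<close> are
      contained in these disjoint singletons.\<close>
    moreover have "U \<inter> \<Inter>(fst ` ?S) = {}"
      using z equivD(4)[OF E] by (auto simp: lower_approx_def)
    ultimately have "\<Sqinter>\<^bsub>?L\<^esub>?S = ({}, B)"
      unfolding inf_product[OF E tol car] by simp
    with meet obtain X where X: "X \<subseteq> U" "lower_approx U E X = {}" "upper_approx U T X = B"
      unfolding rough_sets_def by auto
    from X b obtain y where y: "y \<in> X" unfolding upper_approx_def by blast
    have yU: "y \<in> U" using X y by blast
    have "y \<notin> singletons U E"
    proof
      assume "y \<in> singletons U E"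
      then have "y \<in> lower_approx U E X"
        using y by (simp add: lower_approx_def singletons_def)
      then show False using X(2) by simp
    qed
    \<comment> \<open>Every neighbour of \<open>y \<in> X\<close> belongs to the upper approximation
      of \<open>X\<close>, which is \<open>B\<close>.\<close>
    moreover have "T `` {y} \<subseteq> B"
      using y toleranceD(2,3)[OF tol] unfolding X(3)[symmetric] upper_approx_def by blast
    ultimately show "\<exists>y\<in>U. y \<notin> singletons U E \<and> T `` {y} \<subseteq> T `` {x}"
      using yU BT[OF B(2)] by blast
  qed
next
  note tol = assms(1) and E = assms(4)
  assume ?dense
  note iff = rough_sets_iff[OF assms this]
  have RSD: "fst p \<in> lower_approx U E ` Pow U" "snd p \<in> upper_approx U T ` Pow U"
    "upper_approx U T (fst p) \<subseteq> snd p" "snd p \<inter> singletons U T \<subseteq> fst p" if "p \<in> ?RS" for p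
    using that iff[of "fst p" "snd p"] by auto
  have car: "?RS \<subseteq> carrier ?L"
    unfolding carrier_product[OF E tol] by (auto simp: rough_sets_def)
  have "\<Squnion>\<^bsub>?L\<^esub>S \<in> ?RS \<and> \<Sqinter>\<^bsub>?L\<^esub>S \<in> ?RS" if S: "S \<subseteq> ?RS" for S
  proof
    have Sc: "S \<subseteq> carrier ?L" using S car by blast
    have up: "upper_approx U T (fst p) \<subseteq> snd p" and down: "snd p \<inter> singletons U T \<subseteq> fst p"
      if "p \<in> S" for p using RSD S that by blast+
    have "(\<Union>(fst ` S), \<Union>(snd ` S)) \<in> carrier ?L"
      using least_product[OF E tol Sc] by (auto simp: least_def Upper_def)
    moreover have "upper_approx U T (\<Union>(fst ` S)) \<subseteq> \<Union>(snd ` S)"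
      using up unfolding upper_approx_def by blast
    ultimately show "\<Squnion>\<^bsub>?L\<^esub>S \<in> ?RS"
      using down unfolding sup_product[OF E tol Sc] iff carrier_product[OF E tol] by blast
    let ?A = "U \<inter> \<Inter>(fst ` S)" and ?W = "U \<inter> \<Inter>(snd ` S)"
    have "(?A, upper_approx U T (lower_approx U T ?W)) \<in> carrier ?L"
      using greatest_product[OF E tol Sc] by (auto simp: greatest_def Lower_def)
    moreover have "upper_approx U T ?A \<subseteq> ?W"
      using up unfolding upper_approx_def by blast
    \<comment> \<open>The meet in the upper lattice may be smaller than \<open>?W\<close>, but it is
      the largest upper approximation inside \<open>?W\<close>, so it still contains that of
      \<open>?A\<close>.\<close>
    then have "upper_approx U T ?A \<subseteq> upper_approx U T (lower_approx U T ?W)"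
      by (intro upper_lower_approx_greatest(2)[OF tol]) blast+
    moreover have "upper_approx U T (lower_approx U T ?W) \<subseteq> ?W"
      by (rule upper_lower_approx_greatest(1)[OF tol]) simp
    then have "upper_approx U T (lower_approx U T ?W) \<inter> singletons U T \<subseteq> ?A"
      using down by blast
    ultimately show "\<Sqinter>\<^bsub>?L\<^esub>S \<in> ?RS"
      unfolding inf_product[OF E tol Sc] iff carrier_product[OF E tol] by blast
  qed
  then show "complete_sublattice ?RS ?L"
    using complete_lattice_product[OF E tol] car
    unfolding complete_sublattice_def by (auto simp: rough_sets_def)
qed

end
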